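(* Let $I$ be a normal Riesz $\gamma$-ideal in the GPEA $P$, put $\sim:=\sim_I$, and let $U$ be the $\gamma$-unitization of $P$. Then $\sim^*$ is a Riesz congruence on $U$ iff $\sim$ satisfies the following condition on $P$: (GCR) $a\sim b\Rightarrow\exists\,i,j\in I: i\oplus a=j\oplus b$, or equivalently $\exists\,k,\ell\in I: a\oplus k=b\oplus\ell$.
   Context: $P$ is a GPEA (partial $\oplus$, constant $0$; partial associativity; conjugation; two-sided cancellation; neutral $0$; positivity), ordered by $a\le b$ iff $a\oplus c=b$ for some $c$; for $a\le b$, $a/b$ is the unique $c$ with $a\oplus c=b$ and $b\backslash a$ the unique $d$ with $d\oplus a=b$. $\gamma$ is a unitizing GPEA-automorphism ($\gamma a\oplus b$ defined iff $b\oplus a$ defined). The $\gamma$-unitization $U=P\cup P^\eta$ ($\eta$ a bijection onto a disjoint set, $1:=\eta0$): sums in $P$ as in $P$; $a+\eta b$ defined iff $a\le b$, equal to $\eta(b\backslash a)$; $\eta a+b$ defined iff $\gamma b\le a$, equal to $\eta(\gamma b/a)$; no sums within $P^\eta$; $U$ is a pseudo effect algebra with $\eta a=a^\sim$, $\gamma a=a^{--}$. Ideal: nonempty down-set closed under existing sums; normal: $a\oplus c=c\oplus b$ implies ($a\in I\Leftrightarrow b\in I$); $\gamma$-ideal: $a\in I\Leftrightarrow\gamma a\in I$. Riesz ideal: (R1) if $i\in I$, $i\le a\oplus b$ then $i\le j\oplus k$ for some $j,k\in I$, $j\le a$, $k\le b$; (R2) if $i\in I$, $i\le a$: (i) if $(a\backslash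 i)\oplus b$ exists there is $j\in I$, $j\le b$, with $a\oplus(j/b)$ existing; (ii) if $b\oplus(i/a)$ exists there is $k\in I$, $k\le b$, with $(b\backslash k)\oplus a$ existing. $a\sim_I b$ iff $a\backslash i=b\backslash j$ for some $i,j\in I$, $i\le a$, $j\le b$. $\sim^*$ on $U$: $a\sim^*b$ iff $a\sim b$, $\eta a\sim^*\eta b$ iff $a\sim b$, elements of $P$ and $P^\eta$ never related. A congruence is an equivalence compatible with existing sums ($a\oplus b$, $a_1\oplus b_1$ exist, $a\sim a_1$, $b\sim b_1\Rightarrow a\oplus b\sim a_1\oplus b_1$) such that if $a\oplus b$ exists then each $a_1\sim a$ has some $b_1\sim b$ with $a_1\oplus b_1$ existing and each $b_2\sim b$ has some $a_2\sim a$ with $a_2\oplus b_2$ existing. A Riesz congruence is a congruence satisfying (C4) [$a\sim b$ and ($a\oplus a_1\sim b\oplus b_1$ or $a_1\oplus a\sim b_1\oplus b$) imply $a_1\sim b_1$], (C5$'$) [$a\sim b\oplus c$ implies $a=a_1\oplus a_2$ with $a_1\sim b$, $a_2\sim c$], and (CR) [if $a\sim b$ there are $c,d$ with $c\le a\le d$, $c\le b\le d$, $a\backslash c\sim b\backslash c\sim0$, $d\backslash a\sim d\backslash b\sim0$]. *)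

theory Defs
  imports Main
begin

text \<open>
  Partial binary operations are option-valued: \<open>a \<oplus> b = Some s\<close> means that the sum exists and
  equals \<open>s\<close>, and \<open>a \<oplus> b = None\<close> that it does not exist. The locale below carries no axioms,
  so that the same notions can be used for a GPEA and for its unitization.
\<close>

locale partial_algebra =
  fixes oplus :: "'a \<Rightarrow> 'a \<Rightarrow> 'a option" (infixl "\<oplus>" 65)
    and zero :: 'a ("\<zero>")
begin

definition le :: "'a \<Rightarrow> 'a \<Rightarrow> bool" (infix "\<preceq>" 50) where
  "a \<preceq> b \<longleftrightarrow> (\<exists>c. a \<oplus> c = Some b)"

text \<open>
  \<open>ldiff a b\<close> is \<open>a / b\<close> and \<open>rdiff b a\<close> is \<open>b \ a\<close>. Both are meaningful (in a GPEA) only if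
  \<open>a \<preceq> b\<close>, and every use below is guarded accordingly.
\<close>

definition ldiff :: "'a \<Rightarrow> 'a \<Rightarrow> 'a" where
  "ldiff a b = (THE c. a \<oplus> c = Some b)"

definition rdiff :: "'a \<Rightarrow> 'a \<Rightarrow> 'a" where
  "rdiff b a = (THE d. d \<oplus> a = Some b)"

definition automorphism :: "('a \<Rightarrow> 'a) \<Rightarrow> bool" where
  "automorphism \<gamma> \<longleftrightarrow> bij \<gamma> \<and> (\<forall>a b. \<gamma> a \<oplus> \<gamma> b = map_option \<gamma> (a \<oplus> b))"

definition unitizing_automorphism :: "('a \<Rightarrow> 'a) \<Rightarrow> bool" where
  "unitizing_automorphism \<gamma> \<longleftrightarrow>
     automorphism \<gamma> \<and> (\<forall>a b. \<gamma> a \<oplus> b \<noteq> None \<longleftrightarrow> b \<oplus> a \<noteq> None)"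

definition ideal :: "'a set \<Rightarrow> bool" where
  "ideal I \<longleftrightarrow>
     I \<noteq> {} \<and>
     (\<forall>a b. b \<in> I \<longrightarrow> a \<preceq> b \<longrightarrow> a \<in> I) \<and>
     (\<forall>a b s. a \<in> I \<longrightarrow> b \<in> I \<longrightarrow> a \<oplus> b = Some s \<longrightarrow> s \<in> I)"

definition normal_ideal :: "'a set \<Rightarrow> bool" where
  "normal_ideal I \<longleftrightarrow>
     ideal I \<and>
     (\<forall>a b c s. a \<oplus> c = Some s \<longrightarrow> c \<oplus> b = Some s \<longrightarrow> (a \<in> I \<longleftrightarrow> b \<in> I))"

definition gamma_ideal :: "('a \<Rightarrow> 'a) \<Rightarrow> 'a set \<Rightarrow> bool" where
  "gamma_ideal \<gamma> I \<longleftrightarrow> ideal I \<and> (\<forall>a. a \<in> I \<longleftrightarrow> \<gamma> a \<in> I)"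

definition riesz_ideal :: "'a set \<Rightarrow> bool" where
  "riesz_ideal I \<longleftrightarrow>
     ideal I \<and>
     (\<forall>i a b s. i \<in> I \<longrightarrow> a \<oplus> b = Some s \<longrightarrow> i \<preceq> s \<longrightarrow>
        (\<exists>j\<in>I. \<exists>k\<in>I. \<exists>t. j \<preceq> a \<and> k \<preceq> b \<and> j \<oplus> k = Some t \<and> i \<preceq> t)) \<and>
     (\<forall>i a b. i \<in> I \<longrightarrow> i \<preceq> a \<longrightarrow> rdiff a i \<oplus> b \<noteq> None \<longrightarrow>
        (\<exists>j\<in>I. j \<preceq> b \<and> a \<oplus> ldiff j b \<noteq> None)) \<and>
     (\<forall>i a b. i \<in> I \<longrightarrow> i \<preceq> a \<longrightarrow> b \<oplus> ldiff i a \<noteq> None \<longrightarrow>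
        (\<exists>k\<in>I. k \<preceq> b \<and> rdiff b k \<oplus> a \<noteq> None))"

definition ideal_rel :: "'a set \<Rightarrow> 'a \<Rightarrow> 'a \<Rightarrow> bool" where
  "ideal_rel I a b \<longleftrightarrow> (\<exists>i\<in>I. \<exists>j\<in>I. i \<preceq> a \<and> j \<preceq> b \<and> rdiff a i = rdiff b j)"

definition congruence :: "('a \<Rightarrow> 'a \<Rightarrow> bool) \<Rightarrow> bool" where
  "congruence R \<longleftrightarrow>
     equivp R \<and>
     (\<forall>a b a1 b1 s s1. a \<oplus> b = Some s \<longrightarrow> a1 \<oplus> b1 = Some s1 \<longrightarrow>
        R a a1 \<longrightarrow> R b b1 \<longrightarrow> R s s1) \<and>
     (\<forall>a b. a \<oplus> b \<noteq> None \<longrightarrow>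
        (\<forall>a1. R a1 a \<longrightarrow> (\<exists>b1. R b1 b \<and> a1 \<oplus> b1 \<noteq> None)) \<and>
        (\<forall>b2. R b2 b \<longrightarrow> (\<exists>a2. R a2 a \<and> a2 \<oplus> b2 \<noteq> None)))"

definition riesz_congruence :: "('a \<Rightarrow> 'a \<Rightarrow> bool) \<Rightarrow> bool" where
  "riesz_congruence R \<longleftrightarrow>
     congruence R \<and>
     (\<forall>a b a1 b1. R a b \<longrightarrow>
        (\<exists>s t. a \<oplus> a1 = Some s \<and> b \<oplus> b1 = Some t \<and> R s t) \<or>
        (\<exists>s t. a1 \<oplus> a = Some s \<and> b1 \<oplus> b = Some t \<and> R s t) \<longrightarrow>
        R a1 b1) \<and>
     (\<forall>a b c s. b \<oplus> c = Some s \<longrightarrow> R a s \<longrightarrow>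
        (\<exists>a1 a2. a1 \<oplus> a2 = Some a \<and> R a1 b \<and> R a2 c)) \<and>
     (\<forall>a b. R a b \<longrightarrow>
        (\<exists>c d. c \<preceq> a \<and> a \<preceq> d \<and> c \<preceq> b \<and> b \<preceq> d \<and>
           R (rdiff a c) (rdiff b c) \<and> R (rdiff b c) \<zero> \<and>
           R (rdiff d a) (rdiff d b) \<and> R (rdiff d b) \<zero>))"

end

locale gpea = partial_algebra +
  assumes assoc:
      "(\<exists>s. a \<oplus> b = Some s \<and> s \<oplus> c = Some t) \<longleftrightarrow> (\<exists>s. b \<oplus> c = Some s \<and> a \<oplus> s = Some t)"
    and conjugation: "a \<oplus> b = Some s \<Longrightarrow> \<exists>d e. d \<oplus> a = Some s \<and> b \<oplus> e = Some s"
    and left_cancel: "a \<oplus> b = Some s \<Longrightarrow> a \<oplus> c = Some s \<Longrightarrow> b = c"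
    and right_cancel: "b \<oplus> a = Some s \<Longrightarrow> c \<oplus> a = Some s \<Longrightarrow> b = c"
    and right_zero: "a \<oplus> \<zero> = Some a"
    and left_zero: "\<zero> \<oplus> a = Some a"
    and positivity: "a \<oplus> b = Some \<zero> \<Longrightarrow> a = \<zero> \<and> b = \<zero>"

text \<open>
  The underlying set of the unitization: \<open>Base\<close> is the embedding of \<open>P\<close> into \<open>U\<close> and \<open>Eta\<close> is the
  bijection \<open>\<eta>\<close> of \<open>P\<close> onto a disjoint copy.
\<close>

datatype 'a unitization = Base 'a | Eta 'a

context partial_algebra
begin

fun unit_plus :: "('a \<Rightarrow> 'a) \<Rightarrow> 'a unitization \<Rightarrow> 'a unitization \<Rightarrow> 'a unitization option" where
  "unit_plus \<gamma> (Base a) (Base b) = map_option Base (a \<oplus> b)"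
| "unit_plus \<gamma> (Base a) (Eta b) = (if a \<preceq> b then Some (Eta (rdiff b a)) else None)"
| "unit_plus \<gamma> (Eta a) (Base b) = (if \<gamma> b \<preceq> a then Some (Eta (ldiff (\<gamma> b) a)) else None)"
| "unit_plus \<gamma> (Eta a) (Eta b) = None"

end

fun star_rel :: "('a \<Rightarrow> 'a \<Rightarrow> bool) \<Rightarrow> 'a unitization \<Rightarrow> 'a unitization \<Rightarrow> bool" where
  "star_rel R (Base a) (Base b) = R a b"
| "star_rel R (Eta a) (Eta b) = R a b"
| "star_rel R (Base a) (Eta b) = False"
| "star_rel R (Eta a) (Base b) = False"

end

theory Submission
  imports Defs
begin

text \<open>
  On \<open>P\<close> the relation \<open>\<sim>\<close> of a normal Riesz ideal is always a congruence with (C5'); (GCR) adds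
  cancellation (C4), because two related sums become equal after adding elements of \<open>I\<close>, and can
  then be cancelled in \<open>P\<close>. As \<open>\<eta>\<close> reverses the order and turns sums into differences, each
  congruence axiom on the part \<open>P\<^sup>\<eta>\<close> becomes another one of these properties of \<open>\<sim>\<close> on \<open>P\<close>; for
  instance lower bounds in \<open>P\<^sup>\<eta>\<close> are upper bounds in \<open>P\<close>. Conversely, (CR) for two elements of \<open>P\<close>
  gives an upper bound whose differences are related to \<open>0\<close>; these differences, hence the bound,
  lie in \<open>P\<close>, which is (GCR).
\<close>

section \<open>Order and differences in a GPEA\<close>

context gpea
begin

lemma assoc_rightE:
  assumes "a \<oplus> b = Some s" "s \<oplus> c = Some t"
  obtains u where "b \<oplus> c = Some u" "a \<oplus> u = Some t"
  using assms assoc by blast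

lemma assoc_leftE:
  assumes "b \<oplus> c = Some u" "a \<oplus> u = Some t"
  obtains s where "a \<oplus> b = Some s" "s \<oplus> c = Some t"
  using assms assoc by blast

text \<open>Conjugation moves a complement from one side to the other.\<close>

lemma le_iff_left: "a \<preceq> b \<longleftrightarrow> (\<exists>d. d \<oplus> a = Some b)"
  unfolding le_def using conjugation by blast

lemma le_sum_left: "a \<oplus> b = Some s \<Longrightarrow> a \<preceq> s"
  by (auto simp: le_def)

lemma le_sum_right: "a \<oplus> b = Some s \<Longrightarrow> b \<preceq> s"
  by (auto simp: le_iff_left)

lemma le_trans:
  assumes "a \<preceq> b" "b \<preceq> c"
  shows "a \<preceq> c"
  using assms unfolding le_def by (meson assoc_rightE)

lemma ldiff_eq: "a \<oplus> c = Some b \<Longrightarrow> ldiff a b = c"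
  unfolding ldiff_def by (blast intro: left_cancel)

lemma rdiff_eq: "d \<oplus> a = Some b \<Longrightarrow> rdiff b a = d"
  unfolding rdiff_def by (blast intro: right_cancel)

abbreviation gcr :: "'a set \<Rightarrow> bool" where
  "gcr I \<equiv> \<forall>a b. ideal_rel I a b \<longrightarrow>
     (\<exists>i\<in>I. \<exists>j\<in>I. \<exists>s. i \<oplus> a = Some s \<and> j \<oplus> b = Some s)"

end

section \<open>The relation of a normal Riesz ideal\<close>

locale gpea_normal_riesz_ideal = gpea +
  fixes I :: "'a set"
  assumes normal: "normal_ideal I"
    and riesz: "riesz_ideal I"
begin

abbreviation rel (infix "\<sim>" 50) where "a \<sim> b \<equiv> ideal_rel I a b"

lemma ideal: "ideal I"
  using normal by (simp add: normal_ideal_def)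

lemma down: "b \<in> I \<Longrightarrow> a \<preceq> b \<Longrightarrow> a \<in> I"
  using ideal unfolding ideal_def by blast

lemma sum_mem: "a \<in> I \<Longrightarrow> b \<in> I \<Longrightarrow> a \<oplus> b = Some s \<Longrightarrow> s \<in> I"
  using ideal unfolding ideal_def by blast

lemma zero_mem: "\<zero> \<in> I"
proof -
  obtain a where "a \<in> I" using ideal unfolding ideal_def by blast
  then show ?thesis using down le_sum_left left_zero by blast
qed

text \<open>Conjugation supplies the other summand, and normality puts it into
  \<open>I\<close>.\<close>

lemma shift_right:
  assumes "i \<in> I" "i \<oplus> a = Some s"
  obtains j where "j \<in> I" "a \<oplus> j = Some s"
proof -
  obtain e where "a \<oplus> e = Some s" using assms conjugation by blast
  moreover from this have "e \<in> I" using assms normal unfolding normal_ideal_def by blast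
  ultimately show thesis using that by blast
qed

lemma shift_left:
  assumes "i \<in> I" "a \<oplus> i = Some s"
  obtains j where "j \<in> I" "j \<oplus> a = Some s"
proof -
  obtain e where "e \<oplus> a = Some s" using assms conjugation by blast
  moreover from this have "e \<in> I" using assms normal unfolding normal_ideal_def by blast
  ultimately show thesis using that by blast
qed

text \<open>The common value of the two differences becomes the witness \<open>d\<close>; this
  eliminates \<open>rdiff\<close>.\<close>

lemma rel_iff: "a \<sim> b \<longleftrightarrow> (\<exists>d. \<exists>i\<in>I. \<exists>j\<in>I. d \<oplus> i = Some a \<and> d \<oplus> j = Some b)"
proof
  assume "a \<sim> b"
  then obtain i j where ij: "i \<in> I" "j \<in> I" "i \<preceq> a" "j \<preceq> b" "rdiff a i = rdiff b j"
    by (auto simp: ideal_rel_def)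
  then obtain d e where "d \<oplus> i = Some a" "e \<oplus> j = Some b"
    unfolding le_iff_left by blast
  moreover from this have "d = e" using ij(5) rdiff_eq by auto
  ultimately show "\<exists>d. \<exists>i\<in>I. \<exists>j\<in>I. d \<oplus> i = Some a \<and> d \<oplus> j = Some b"
    using ij by blast
next
  assume "\<exists>d. \<exists>i\<in>I. \<exists>j\<in>I. d \<oplus> i = Some a \<and> d \<oplus> j = Some b"
  then obtain d i j where "i \<in> I" "j \<in> I" "d \<oplus> i = Some a" "d \<oplus> j = Some b" by blast
  moreover from this have "i \<preceq> a" "j \<preceq> b" "rdiff a i = rdiff b j"
    using le_sum_right rdiff_eq by auto
  ultimately show "a \<sim> b" unfolding ideal_rel_def by blast
qed

lemma rel_iff_left: "a \<sim> b \<longleftrightarrow> (\<exists>d. \<exists>i\<in>I. \<exists>j\<in>I. i \<oplus> d = Some a \<and> j \<oplus> d = Some b)"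
proof
  assume "a \<sim> b"
  then obtain d i j where d: "i \<in> I" "j \<in> I" "d \<oplus> i = Some a" "d \<oplus> j = Some b"
    using rel_iff by blast
  obtain i' where "i' \<in> I" "i' \<oplus> d = Some a" using shift_left[OF d(1,3)] .
  moreover obtain j' where "j' \<in> I" "j' \<oplus> d = Some b" using shift_left[OF d(2,4)] .
  ultimately show "\<exists>d. \<exists>i\<in>I. \<exists>j\<in>I. i \<oplus> d = Some a \<and> j \<oplus> d = Some b" by blast
next
  assume "\<exists>d. \<exists>i\<in>I. \<exists>j\<in>I. i \<oplus> d = Some a \<and> j \<oplus> d = Some b"
  then obtain d i j where d: "i \<in> I" "j \<in> I" "i \<oplus> d = Some a" "j \<oplus> d = Some b" by blast
  obtain i' where "i' \<in> I" "d \<oplus> i' = Some a" using shift_right[OF d(1,3)] .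
  moreover obtain j' where "j' \<in> I" "d \<oplus> j' = Some b" using shift_right[OF d(2,4)] .
  ultimately show "a \<sim> b" unfolding rel_iff by blast
qed

lemma rel_refl: "a \<sim> a"
  unfolding rel_iff using zero_mem right_zero by blast

lemma rel_sym: "a \<sim> b \<Longrightarrow> b \<sim> a"
  unfolding rel_iff by blast

lemma sum_right_rel: "i \<in> I \<Longrightarrow> d \<oplus> i = Some a \<Longrightarrow> a \<sim> d"
  unfolding rel_iff using zero_mem right_zero by blast

lemma sum_left_rel: "i \<in> I \<Longrightarrow> i \<oplus> d = Some a \<Longrightarrow> a \<sim> d"
  unfolding rel_iff_left using zero_mem left_zero by blast

lemma R1:
  assumes "i \<in> I" "a \<oplus> b = Some s" "i \<preceq> s"
  obtains j k t where "j \<in> I" "k \<in> I" "j \<preceq> a" "k \<preceq> b" "j \<oplus> k = Some t" "i \<preceq> t"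
  using riesz assms unfolding riesz_ideal_def by meson

text \<open>Condition (R2)(i) in terms of sums: \<open>d\<close> stands for \<open>rdiff a i\<close>
  and \<open>c\<close> for \<open>ldiff j b\<close>.\<close>

lemma R2_left:
  assumes "i \<in> I" "d \<oplus> i = Some a" "d \<oplus> b \<noteq> None"
  obtains j c where "j \<in> I" "j \<oplus> c = Some b" "a \<oplus> c \<noteq> None"
proof -
  have "i \<preceq> a" "rdiff a i \<oplus> b \<noteq> None"
    using assms le_sum_right rdiff_eq by auto
  then obtain j where "j \<in> I" "j \<preceq> b" "a \<oplus> ldiff j b \<noteq> None"
    using riesz assms(1) unfolding riesz_ideal_def by blast
  moreover from this obtain c where "j \<oplus> c = Some b" unfolding le_def by blast
  ultimately show thesis using that ldiff_eq by simp
qed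

lemma R2_right:
  assumes "i \<in> I" "i \<oplus> d = Some a" "b \<oplus> d \<noteq> None"
  obtains k c where "k \<in> I" "c \<oplus> k = Some b" "c \<oplus> a \<noteq> None"
proof -
  have "i \<preceq> a" "b \<oplus> ldiff i a \<noteq> None"
    using assms le_sum_left ldiff_eq by auto
  then obtain k where "k \<in> I" "k \<preceq> b" "rdiff b k \<oplus> a \<noteq> None"
    using riesz assms(1) unfolding riesz_ideal_def by blast
  moreover from this obtain c where "c \<oplus> k = Some b" unfolding le_iff_left by blast
  ultimately show thesis using that rdiff_eq by simp
qed

text \<open>By (R1) for \<open>k\<close> below the sum of \<open>d\<close> and \<open>j\<close>, a
  piece \<open>k1\<close> can be removed from \<open>d\<close> so that the rest \<open>f\<close>
  lies below both \<open>d\<close> and \<open>e\<close>, with remainders in \<open>I\<close>. Then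
  \<open>f\<close> is a common part of \<open>a\<close> and \<open>c\<close>.\<close>

lemma rel_trans:
  assumes "a \<sim> b" "b \<sim> c"
  shows "a \<sim> c"
proof -
  obtain d i j where 1: "i \<in> I" "j \<in> I" "d \<oplus> i = Some a" "d \<oplus> j = Some b"
    using assms(1) rel_iff by blast
  obtain e k l where 2: "k \<in> I" "l \<in> I" "e \<oplus> k = Some b" "e \<oplus> l = Some c"
    using assms(2) rel_iff by blast
  obtain k1 k2 t where k: "k1 \<in> I" "k2 \<in> I" "k1 \<preceq> d" "k2 \<preceq> j" "k1 \<oplus> k2 = Some t" "k \<preceq> t"
    using R1[OF 2(1) 1(4) le_sum_right[OF 2(3)]] by blast
  obtain f where f: "f \<oplus> k1 = Some d" using k(3) le_iff_left by blast
  obtain m where m: "k1 \<oplus> j = Some m" "f \<oplus> m = Some b" using assoc_rightE[OF f 1(4)] .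
  have mI: "m \<in> I" using sum_mem k(1) 1(2) m(1) by blast
  obtain y where y: "k2 \<oplus> y = Some j" using k(4) le_def by blast
  \<comment> \<open>Replacing \<open>k2\<close> by the larger \<open>j\<close> in
    \<open>k1 \<oplus> k2\<close> turns \<open>t\<close> into \<open>m\<close>.\<close>
  have "t \<preceq> m" using assoc_leftE[OF y m(1)] k(5) le_sum_left by (metis option.inject)
  then obtain n where n: "n \<oplus> k = Some m" using k(6) le_trans le_iff_left by blast
  have nI: "n \<in> I" using down[OF mI le_sum_left[OF n]] .
  \<comment> \<open>Both \<open>f \<oplus> n\<close> and \<open>e\<close> yield \<open>b\<close>
    when \<open>k\<close> is added on the right.\<close>
  have fn: "f \<oplus> n = Some e"
    using assoc_leftE[OF n m(2)] right_cancel 2(3) by metis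
  obtain p where p: "k1 \<oplus> i = Some p" "f \<oplus> p = Some a" using assoc_rightE[OF f 1(3)] .
  obtain q where q: "n \<oplus> l = Some q" "f \<oplus> q = Some c" using assoc_rightE[OF fn 2(4)] .
  show ?thesis unfolding rel_iff using p q sum_mem k(1) 1(1) nI 2(2) by blast
qed

text \<open>The pieces \<open>i\<close> and \<open>k\<close> meet in the middle of the sum, so they
  combine to one element of \<open>I\<close>, which normality carries to the right of
  \<open>e\<close>.\<close>

lemma rel_sum_aux:
  assumes "i \<in> I" "k \<in> I" "d \<oplus> i = Some a" "k \<oplus> e = Some b" "a \<oplus> b = Some s"
  obtains u m where "d \<oplus> e = Some u" "m \<in> I" "u \<oplus> m = Some s"
proof -
  obtain v where v: "i \<oplus> b = Some v" "d \<oplus> v = Some s" using assoc_rightE[OF assms(3,5)] .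
  obtain w where w: "i \<oplus> k = Some w" "w \<oplus> e = Some v" using assoc_leftE[OF assms(4) v(1)] .
  obtain m where m: "m \<in> I" "e \<oplus> m = Some v" using shift_right w sum_mem assms by metis
  show thesis using assoc_leftE[OF m(2) v(2)] that m(1) by metis
qed

lemma rel_sum:
  assumes "a \<oplus> b = Some s" "a1 \<oplus> b1 = Some s1" "a \<sim> a1" "b \<sim> b1"
  shows "s \<sim> s1"
proof -
  obtain d i j where 1: "i \<in> I" "j \<in> I" "d \<oplus> i = Some a" "d \<oplus> j = Some a1"
    using assms rel_iff by blast
  obtain e k l where 2: "k \<in> I" "l \<in> I" "k \<oplus> e = Some b" "l \<oplus> e = Some b1"
    using assms rel_iff_left by blast
  show ?thesis
    using rel_sum_aux[OF 1(1) 2(1) 1(3) 2(3) assms(1)] rel_sum_aux[OF 1(2) 2(2) 1(4) 2(4) assms(2)]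
    unfolding rel_iff by (metis option.inject)
qed

text \<open>First \<open>a\<close> is shrunk to the common part \<open>d\<close>; then (R2) enlarges
  \<open>d\<close> to \<open>a1\<close> at the price of removing an element of \<open>I\<close> from
  the left of \<open>b\<close>.\<close>

lemma rel_sum_exists_right:
  assumes "a \<oplus> b = Some s" "a1 \<sim> a"
  obtains b1 s1 where "b1 \<sim> b" "a1 \<oplus> b1 = Some s1" "s1 \<sim> s"
proof -
  obtain d i j where 1: "i \<in> I" "j \<in> I" "d \<oplus> i = Some a" "d \<oplus> j = Some a1"
    using assms rel_iff by (metis rel_sym)
  obtain u where "d \<oplus> b = Some u"
    using rel_sum_aux[OF 1(1) zero_mem 1(3) left_zero assms(1)] by blast
  then obtain k c s1 where "k \<in> I" "k \<oplus> c = Some b" "a1 \<oplus> c = Some s1"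
    using R2_left[OF 1(2) 1(4)] by blast
  then show thesis using that rel_sum assms rel_sym sum_left_rel by blast
qed

lemma rel_sum_exists_left:
  assumes "a \<oplus> b = Some s" "b1 \<sim> b"
  obtains a1 s1 where "a1 \<sim> a" "a1 \<oplus> b1 = Some s1" "s1 \<sim> s"
proof -
  obtain d i j where 1: "i \<in> I" "j \<in> I" "i \<oplus> d = Some b" "j \<oplus> d = Some b1"
    using assms rel_iff_left by (metis rel_sym)
  obtain u where "a \<oplus> d = Some u"
    using rel_sum_aux[OF zero_mem 1(1) right_zero 1(3) assms(1)] by blast
  then obtain k c s1 where "k \<in> I" "c \<oplus> k = Some a" "c \<oplus> b1 = Some s1"
    using R2_right[OF 1(2) 1(4)] by blast
  then show thesis using that rel_sum assms rel_sym sum_right_rel by blast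
qed

text \<open>
  Since \<open>\<preceq>\<close> is two-sided, \<open>j \<preceq> j1 \<oplus> j2 \<preceq> b \<oplus> j2\<close> lets \<open>j\<close> be cancelled from the left of
  \<open>(b \<oplus> j2) \<oplus> c0\<close>, which avoids commuting \<open>j2\<close> past \<open>b\<close>.
\<close>

lemma decompose_remainder:
  assumes "j \<in> I" "j \<oplus> e = Some s" "b \<oplus> c = Some s"
  obtains b1 c1 where "b1 \<oplus> c1 = Some e" "b1 \<sim> b" "c1 \<sim> c"
proof -
  obtain j1 j2 t where k: "j1 \<in> I" "j2 \<in> I" "j1 \<preceq> b" "j2 \<preceq> c" "j1 \<oplus> j2 = Some t" "j \<preceq> t"
    using R1[OF assms(1,3) le_sum_left[OF assms(2)]] by blast
  obtain c0 where c0: "j2 \<oplus> c0 = Some c" using k(4) le_def by blast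
  obtain v where v: "b \<oplus> j2 = Some v" "v \<oplus> c0 = Some s" using assoc_leftE[OF c0 assms(3)] .
  obtain b0 where b0: "b0 \<oplus> j1 = Some b" using k(3) le_iff_left by blast
  have "t \<preceq> v" using assoc_rightE[OF b0 v(1)] k(5) le_sum_right by (metis option.inject)
  then obtain q where q: "j \<oplus> q = Some v" using k(6) le_trans le_def by blast
  have "q \<oplus> c0 = Some e"
    using assoc_rightE[OF q v(2)] left_cancel assms(2) by metis
  moreover have "q \<sim> b"
    using sum_left_rel[OF assms(1) q] sum_right_rel[OF k(2) v(1)] rel_sym rel_trans by blast
  moreover have "c0 \<sim> c" using sum_left_rel k(2) c0 rel_sym by blast
  ultimately show thesis using that by blast
qed

text \<open>Only the common part \<open>e\<close> of \<open>a\<close> and \<open>s\<close> is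
  decomposed; the leftover \<open>i\<close> of \<open>a\<close> is then absorbed by the first
  component. This is (C5').\<close>

lemma rel_decompose:
  assumes "b \<oplus> c = Some s" "a \<sim> s"
  obtains a1 a2 where "a1 \<oplus> a2 = Some a" "a1 \<sim> b" "a2 \<sim> c"
proof -
  obtain e i j where 1: "i \<in> I" "j \<in> I" "i \<oplus> e = Some a" "j \<oplus> e = Some s"
    using assms rel_iff_left by blast
  obtain b1 c1 where 2: "b1 \<oplus> c1 = Some e" "b1 \<sim> b" "c1 \<sim> c"
    using decompose_remainder[OF 1(2,4) assms(1)] .
  obtain v where "i \<oplus> b1 = Some v" "v \<oplus> c1 = Some a" using assoc_leftE[OF 2(1) 1(3)] .
  then show thesis using that 2 sum_left_rel 1(1) rel_trans by blast
qed

text \<open>By positivity the common part with \<open>\<zero>\<close> is \<open>\<zero>\<close>, so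
  \<open>a\<close> is its own remainder.\<close>

lemma rel_zero_iff: "a \<sim> \<zero> \<longleftrightarrow> a \<in> I"
proof
  assume "a \<sim> \<zero>"
  then obtain d i j where "i \<in> I" "d \<oplus> i = Some a" "d \<oplus> j = Some \<zero>"
    unfolding rel_iff by blast
  then show "a \<in> I" using positivity left_zero by (metis option.inject)
next
  assume "a \<in> I"
  then show "a \<sim> \<zero>" using sum_right_rel left_zero by blast
qed

lemma rel_of_mem: "a \<in> I \<Longrightarrow> b \<in> I \<Longrightarrow> a \<sim> b"
  using rel_zero_iff rel_sym rel_trans by blast

text \<open>Normality moves each summand from \<open>I\<close> to the other side while keeping the
  bound \<open>s\<close>; this relates the two forms of (GCR) pair by pair.\<close>

lemma upper_left_iff_upper_right:
  "(\<exists>i\<in>I. \<exists>j\<in>I. \<exists>s. i \<oplus> a = Some s \<and> j \<oplus> b = Some s) \<longleftrightarrow>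
   (\<exists>k\<in>I. \<exists>l\<in>I. \<exists>s. a \<oplus> k = Some s \<and> b \<oplus> l = Some s)"
  (is "?L \<longleftrightarrow> ?R")
proof
  assume ?L
  then obtain i j s where d: "i \<in> I" "j \<in> I" "i \<oplus> a = Some s" "j \<oplus> b = Some s" by blast
  obtain k where "k \<in> I" "a \<oplus> k = Some s" using shift_right[OF d(1,3)] .
  moreover obtain l where "l \<in> I" "b \<oplus> l = Some s" using shift_right[OF d(2,4)] .
  ultimately show ?R by blast
next
  assume ?R
  then obtain i j s where d: "i \<in> I" "j \<in> I" "a \<oplus> i = Some s" "b \<oplus> j = Some s" by blast
  obtain k where "k \<in> I" "k \<oplus> a = Some s" using shift_left[OF d(1,3)] .
  moreover obtain l where "l \<in> I" "l \<oplus> b = Some s" using shift_left[OF d(2,4)] .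
  ultimately show ?L by blast
qed

section \<open>Cancellation under (GCR)\<close>

lemma rel_cancel_left_same:
  assumes "gcr I" "d \<oplus> x = Some s" "d \<oplus> y = Some t" "s \<sim> t"
  shows "x \<sim> y"
proof -
  \<comment> \<open>The elements of \<open>I\<close> are added on the right, so that
    \<open>d\<close> stays leftmost and can be cancelled in P.\<close>
  obtain k l u where u: "k \<in> I" "l \<in> I" "s \<oplus> k = Some u" "t \<oplus> l = Some u"
    using assms upper_left_iff_upper_right by blast
  obtain v where v: "x \<oplus> k = Some v" "d \<oplus> v = Some u" using assoc_rightE[OF assms(2) u(3)] .
  obtain w where w: "y \<oplus> l = Some w" "d \<oplus> w = Some u" using assoc_rightE[OF assms(3) u(4)] .
  have "v = w" using left_cancel v w by blast
  then show ?thesis using v w u sum_right_rel rel_sym rel_trans by metis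
qed

lemma rel_cancel_right_same:
  assumes "gcr I" "x \<oplus> d = Some s" "y \<oplus> d = Some t" "s \<sim> t"
  shows "x \<sim> y"
proof -
  obtain k l u where u: "k \<in> I" "l \<in> I" "k \<oplus> s = Some u" "l \<oplus> t = Some u"
    using assms by blast
  obtain v where v: "k \<oplus> x = Some v" "v \<oplus> d = Some u" using assoc_leftE[OF assms(2) u(3)] .
  obtain w where w: "l \<oplus> y = Some w" "w \<oplus> d = Some u" using assoc_leftE[OF assms(3) u(4)] .
  have "v = w" using right_cancel v w by blast
  then show ?thesis using v w u sum_left_rel rel_sym rel_trans by metis
qed

text \<open>Regrouping around the common part \<open>d\<close> of \<open>a\<close> and
  \<open>b\<close> reduces this to a shared left summand; \<open>x\<close> and \<open>y\<close>
  differ from \<open>a1\<close> and \<open>b1\<close> only by left summands in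
  \<open>I\<close>.\<close>

lemma rel_cancel_left:
  assumes "gcr I" "a \<sim> b" "a \<oplus> a1 = Some s" "b \<oplus> b1 = Some t" "s \<sim> t"
  shows "a1 \<sim> b1"
proof -
  obtain d i j where 1: "i \<in> I" "j \<in> I" "d \<oplus> i = Some a" "d \<oplus> j = Some b"
    using assms rel_iff by blast
  obtain x where x: "i \<oplus> a1 = Some x" "d \<oplus> x = Some s" using assoc_rightE[OF 1(3) assms(3)] .
  obtain y where y: "j \<oplus> b1 = Some y" "d \<oplus> y = Some t" using assoc_rightE[OF 1(4) assms(4)] .
  have "x \<sim> y" using rel_cancel_left_same assms x y by blast
  then show ?thesis using x y 1 sum_left_rel rel_sym rel_trans by blast
qed

lemma rel_cancel_right:
  assumes "gcr I" "a \<sim> b" "a1 \<oplus> a = Some s" "b1 \<oplus> b = Some t" "s \<sim> t"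
  shows "a1 \<sim> b1"
proof -
  obtain d i j where 1: "i \<in> I" "j \<in> I" "i \<oplus> d = Some a" "j \<oplus> d = Some b"
    using assms rel_iff_left by blast
  obtain x where x: "a1 \<oplus> i = Some x" "x \<oplus> d = Some s" using assoc_leftE[OF 1(3) assms(3)] .
  obtain y where y: "b1 \<oplus> j = Some y" "y \<oplus> d = Some t" using assoc_leftE[OF 1(4) assms(4)] .
  have "x \<sim> y" using rel_cancel_right_same assms x y by blast
  then show ?thesis using x y 1 sum_right_rel rel_sym rel_trans by blast
qed

end

section \<open>The unitization and its relation\<close>

locale gpea_unitization_ideal = gpea_normal_riesz_ideal +
  fixes \<gamma> :: "'a \<Rightarrow> 'a"
  assumes unitizing: "unitizing_automorphism \<gamma>"
    and gamma_ideal: "gamma_ideal \<gamma> I"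
begin

interpretation U: partial_algebra "unit_plus \<gamma>" "Base \<zero>" .

abbreviation urel where "urel \<equiv> star_rel (\<sim>)"

lemma automorphism: "automorphism \<gamma>"
  using unitizing by (simp add: unitizing_automorphism_def)

lemma gamma_surj:
  obtains x where "\<gamma> x = y"
  using automorphism unfolding automorphism_def by (metis bij_pointE)

text \<open>The automorphism preserves and reflects sums and membership in \<open>I\<close>, and
  surjectivity pulls witnesses back.\<close>

lemma gamma_rel_iff: "\<gamma> a \<sim> \<gamma> b \<longleftrightarrow> a \<sim> b"
proof -
  have inj: "inj \<gamma>" and hom: "\<gamma> x \<oplus> \<gamma> y = map_option \<gamma> (x \<oplus> y)" for x y
    using automorphism by (auto simp: automorphism_def bij_def)
  have sum: "\<gamma> x \<oplus> \<gamma> y = Some (\<gamma> z) \<longleftrightarrow> x \<oplus> y = Some z" for x y z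
    using hom inj by (cases "x \<oplus> y") (auto dest: injD)
  have mem: "\<gamma> x \<in> I \<longleftrightarrow> x \<in> I" for x
    using gamma_ideal by (auto simp: gamma_ideal_def)
  show ?thesis
  proof
    assume "\<gamma> a \<sim> \<gamma> b"
    then obtain d i j where d: "i \<in> I" "j \<in> I" "d \<oplus> i = Some (\<gamma> a)" "d \<oplus> j = Some (\<gamma> b)"
      unfolding rel_iff by blast
    moreover obtain d' where "\<gamma> d' = d" using gamma_surj .
    moreover obtain i' where "\<gamma> i' = i" using gamma_surj .
    moreover obtain j' where "\<gamma> j' = j" using gamma_surj .
    ultimately show "a \<sim> b" unfolding rel_iff using mem sum by blast
  next
    assume "a \<sim> b"
    then show "\<gamma> a \<sim> \<gamma> b" unfolding rel_iff using mem sum by blast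
  qed
qed

text \<open>This rule and the next two express sums in the unitization by sums in P, without order
  or differences; they replace the defining equations in the simp set.\<close>

lemma unit_plus_Base_Base [simp]:
  "unit_plus \<gamma> (Base a) (Base b) = Some z \<longleftrightarrow> (\<exists>u. z = Base u \<and> a \<oplus> b = Some u)"
  by auto

lemma unit_plus_Base_Eta [simp]:
  "unit_plus \<gamma> (Base a) (Eta b) = Some z \<longleftrightarrow> (\<exists>u. z = Eta u \<and> u \<oplus> a = Some b)"
  by (auto simp: le_iff_left rdiff_eq intro: right_cancel)

lemma unit_plus_Eta_Base [simp]:
  "unit_plus \<gamma> (Eta a) (Base b) = Some z \<longleftrightarrow> (\<exists>u. z = Eta u \<and> \<gamma> b \<oplus> u = Some a)"
  by (auto simp: le_def ldiff_eq intro: left_cancel)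

declare unit_plus.simps(1-3) [simp del]

text \<open>Every axiom on the unitization is checked along these cases; the last fact of each is an
  equation in P, to which the results on \<open>\<sim>\<close> apply.\<close>

lemma unit_plus_cases:
  assumes "unit_plus \<gamma> x y = Some z"
  obtains a b u where "x = Base a" "y = Base b" "z = Base u" "a \<oplus> b = Some u"
  | a b u where "x = Base a" "y = Eta b" "z = Eta u" "u \<oplus> a = Some b"
  | a b u where "x = Eta a" "y = Base b" "z = Eta u" "\<gamma> b \<oplus> u = Some a"
  using assms by (cases x; cases y) auto

lemma urel_Base: "urel x (Base b) \<longleftrightarrow> (\<exists>a. x = Base a \<and> a \<sim> b)"
  by (cases x) auto

lemma urel_Eta: "urel x (Eta b) \<longleftrightarrow> (\<exists>a. x = Eta a \<and> a \<sim> b)"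
  by (cases x) auto

lemma urel_Base': "urel (Base b) x \<longleftrightarrow> (\<exists>a. x = Base a \<and> b \<sim> a)"
  by (cases x) auto

lemma urel_Eta': "urel (Eta b) x \<longleftrightarrow> (\<exists>a. x = Eta a \<and> b \<sim> a)"
  by (cases x) auto

lemmas urel_simps = urel_Base urel_Eta urel_Base' urel_Eta'

section \<open>Congruence axioms on the unitization\<close>

lemma equivp_urel: "equivp urel"
proof (intro equivpI reflpI sympI transpI)
  show "urel x x" for x by (cases x) (auto simp: rel_refl)
  show "urel x y \<Longrightarrow> urel y x" for x y by (cases x) (auto simp: urel_simps rel_sym)
  show "urel x y \<Longrightarrow> urel y z \<Longrightarrow> urel x z" for x y z
    by (cases y) (auto simp: urel_simps intro: rel_trans)
qed

text \<open>A mixed sum is a difference in P, so compatibility there is cancellation for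
  \<open>\<sim>\<close>, which is where (GCR) enters.\<close>

lemma urel_sum:
  assumes "gcr I" "unit_plus \<gamma> x y = Some z" "unit_plus \<gamma> x1 y1 = Some z1"
    "urel x x1" "urel y y1"
  shows "urel z z1"
  using assms(2)
proof (cases rule: unit_plus_cases)
  case (1 a b u)
  then obtain a1 b1 u1 where "x1 = Base a1" "y1 = Base b1" "z1 = Base u1"
    and "a1 \<oplus> b1 = Some u1" "a \<sim> a1" "b \<sim> b1"
    using assms by (auto simp: urel_simps)
  then show ?thesis using 1 rel_sum[OF 1(4)] by auto
next
  case (2 a b u)
  then obtain a1 b1 u1 where "x1 = Base a1" "y1 = Eta b1" "z1 = Eta u1"
    and "u1 \<oplus> a1 = Some b1" "a \<sim> a1" "b \<sim> b1"
    using assms by (auto simp: urel_simps)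
  then show ?thesis using 2 rel_cancel_right[OF assms(1) _ 2(4)] by auto
next
  case (3 a b u)
  then obtain a1 b1 u1 where "x1 = Eta a1" "y1 = Base b1" "z1 = Eta u1"
    and "\<gamma> b1 \<oplus> u1 = Some a1" "a \<sim> a1" "\<gamma> b \<sim> \<gamma> b1"
    using assms by (auto simp: urel_simps gamma_rel_iff)
  then show ?thesis using 3 rel_cancel_left[OF assms(1) _ 3(4)] by auto
qed

text \<open>With an \<open>Eta\<close> second summand, this is existence of sums on the opposite
  side in P; with an \<open>Eta\<close> first summand, a total in P is replaced, which calls for
  (C5').\<close>

lemma urel_sum_exists_right:
  assumes "unit_plus \<gamma> x y = Some z" "urel x1 x"
  shows "\<exists>y1. urel y1 y \<and> (\<exists>z1. unit_plus \<gamma> x1 y1 = Some z1)"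
  using assms(1)
proof (cases rule: unit_plus_cases)
  case (1 a b u)
  then obtain a1 where a1: "x1 = Base a1" "a1 \<sim> a" using assms by (auto simp: urel_simps)
  obtain b1 s where "b1 \<sim> b" "a1 \<oplus> b1 = Some s"
    using rel_sum_exists_right[OF 1(4) a1(2)] by blast
  then show ?thesis using 1 a1 by (intro exI[of _ "Base b1"]) auto
next
  case (2 a b u)
  then obtain a1 where a1: "x1 = Base a1" "a1 \<sim> a" using assms by (auto simp: urel_simps)
  obtain c s where "c \<oplus> a1 = Some s" "s \<sim> b"
    using rel_sum_exists_left[OF 2(4) a1(2)] by blast
  then show ?thesis using 2 a1 by (intro exI[of _ "Eta s"]) auto
next
  case (3 a b u)
  then obtain a1 where a1: "x1 = Eta a1" "a1 \<sim> a" using assms by (auto simp: urel_simps)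
  obtain c d where cd: "c \<oplus> d = Some a1" "c \<sim> \<gamma> b"
    using rel_decompose[OF 3(4) a1(2)] by blast
  obtain b1 where "\<gamma> b1 = c" using gamma_surj .
  then show ?thesis using 3 a1 cd by (intro exI[of _ "Base b1"]) (auto simp: gamma_rel_iff)
qed

text \<open>Now (C5') serves the case of an \<open>Eta\<close> second summand, since that is the one
  replaced.\<close>

lemma urel_sum_exists_left:
  assumes "unit_plus \<gamma> x y = Some z" "urel y1 y"
  shows "\<exists>x1. urel x1 x \<and> (\<exists>z1. unit_plus \<gamma> x1 y1 = Some z1)"
  using assms(1)
proof (cases rule: unit_plus_cases)
  case (1 a b u)
  then obtain b1 where b1: "y1 = Base b1" "b1 \<sim> b" using assms by (auto simp: urel_simps)
  obtain a1 s where "a1 \<sim> a" "a1 \<oplus> b1 = Some s"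
    using rel_sum_exists_left[OF 1(4) b1(2)] by blast
  then show ?thesis using 1 b1 by (intro exI[of _ "Base a1"]) auto
next
  case (2 a b u)
  then obtain b1 where b1: "y1 = Eta b1" "b1 \<sim> b" using assms by (auto simp: urel_simps)
  obtain c d where "c \<oplus> d = Some b1" "d \<sim> a"
    using rel_decompose[OF 2(4) b1(2)] by blast
  then show ?thesis using 2 b1 by (intro exI[of _ "Base d"]) auto
next
  case (3 a b u)
  then obtain b1 where b1: "y1 = Base b1" "b1 \<sim> b" using assms by (auto simp: urel_simps)
  have "\<gamma> b1 \<sim> \<gamma> b" using b1 gamma_rel_iff by blast
  then obtain c s where "\<gamma> b1 \<oplus> c = Some s" "s \<sim> a"
    using rel_sum_exists_right[OF 3(4)] by blast
  then show ?thesis using 3 b1 by (intro exI[of _ "Eta s"]) auto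
qed

lemma congruence_urel: "gcr I \<Longrightarrow> U.congruence urel"
  unfolding U.congruence_def
  using equivp_urel urel_sum urel_sum_exists_left urel_sum_exists_right by blast

section \<open>Cancellation, decomposition and bounds on the unitization\<close>

lemma urel_cancel_left:
  assumes "gcr I" "urel x y" "unit_plus \<gamma> x x1 = Some s" "unit_plus \<gamma> y y1 = Some t" "urel s t"
  shows "urel x1 y1"
  using assms(3)
proof (cases rule: unit_plus_cases)
  case (1 a b u)
  from assms(4) show ?thesis
    by (cases rule: unit_plus_cases) (use 1 assms in \<open>auto intro: rel_cancel_left\<close>)
next
  case (2 a b u)
  \<comment> \<open>The elements to be related are totals of sums in P, so compatibility with sums
    takes the place of cancellation.\<close>
  from assms(4) show ?thesis
    by (cases rule: unit_plus_cases) (use 2 assms in \<open>auto intro: rel_sum\<close>)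
next
  case (3 a b u)
  from assms(4) show ?thesis
  proof (cases rule: unit_plus_cases)
    case (3 a' b' u')
    then have "\<gamma> b \<sim> \<gamma> b'"
      using assms \<open>\<gamma> b \<oplus> u = Some a\<close> \<open>x = Eta a\<close> \<open>s = Eta u\<close>
      by (auto intro: rel_cancel_right)
    then show ?thesis using 3 \<open>x1 = Base b\<close> by (simp add: gamma_rel_iff)
  qed (use 3 assms in auto)
qed

lemma urel_cancel_right:
  assumes "gcr I" "urel x y" "unit_plus \<gamma> x1 x = Some s" "unit_plus \<gamma> y1 y = Some t" "urel s t"
  shows "urel x1 y1"
  using assms(3)
proof (cases rule: unit_plus_cases)
  case (1 a b u)
  from assms(4) show ?thesis
    by (cases rule: unit_plus_cases) (use 1 assms in \<open>auto intro: rel_cancel_right\<close>)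
next
  case (2 a b u)
  from assms(4) show ?thesis
    by (cases rule: unit_plus_cases) (use 2 assms in \<open>auto intro: rel_cancel_left\<close>)
next
  case (3 a b u)
  \<comment> \<open>The instantiation of \<open>rel_sum\<close> exposes the images under
    \<open>\<gamma>\<close>, so that \<open>gamma_rel_iff\<close> reduces its premise to the given
    relation.\<close>
  from assms(4) show ?thesis
    by (cases rule: unit_plus_cases)
      (use 3 assms in \<open>auto intro: rel_sum[of "\<gamma> c" _ _ "\<gamma> d" for c d] simp: gamma_rel_iff\<close>)
qed

text \<open>Decomposing an \<open>Eta\<close> element amounts to extending a sum in P to a related
  element, so the mixed cases rest on existence of sums.\<close>

lemma urel_decompose:
  assumes "unit_plus \<gamma> y z = Some s" "urel x s"
  shows "\<exists>x1 x2. unit_plus \<gamma> x1 x2 = Some x \<and> urel x1 y \<and> urel x2 z"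
  using assms(1)
proof (cases rule: unit_plus_cases)
  case (1 b c u)
  then obtain a where a: "x = Base a" "a \<sim> u" using assms by (auto simp: urel_simps)
  obtain a1 a2 where "a1 \<oplus> a2 = Some a" "a1 \<sim> b" "a2 \<sim> c"
    using rel_decompose[OF 1(4) a(2)] .
  then show ?thesis using 1 a by (intro exI[of _ "Base a1"] exI[of _ "Base a2"]) auto
next
  case (2 b c u)
  then obtain a where a: "x = Eta a" "a \<sim> u" using assms by (auto simp: urel_simps)
  obtain b1 t where "b1 \<sim> b" "a \<oplus> b1 = Some t" "t \<sim> c"
    using rel_sum_exists_right[OF 2(4) a(2)] .
  then show ?thesis using 2 a by (intro exI[of _ "Base b1"] exI[of _ "Eta t"]) auto
next
  case (3 b c u)
  then obtain a where a: "x = Eta a" "a \<sim> u" using assms by (auto simp: urel_simps)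
  obtain d t where "d \<sim> \<gamma> c" "d \<oplus> a = Some t" "t \<sim> b"
    using rel_sum_exists_left[OF 3(4) a(2)] .
  moreover obtain c1 where "\<gamma> c1 = d" using gamma_surj .
  ultimately show ?thesis using 3 a
    by (intro exI[of _ "Eta t"] exI[of _ "Base c1"]) (auto simp: gamma_rel_iff)
qed

lemma rdiff_Base: "d \<oplus> a = Some b \<Longrightarrow> U.rdiff (Base b) (Base a) = Base d"
  unfolding U.rdiff_def
  by (rule the_equality) (auto elim!: unit_plus_cases intro: right_cancel)

text \<open>Adding \<open>Base d\<close> on the left of \<open>Eta b\<close> gives
  \<open>Eta a\<close> exactly when \<open>d\<close> is the right remainder of \<open>a\<close> in
  \<open>b\<close>.\<close>

lemma rdiff_Eta: "a \<oplus> d = Some b \<Longrightarrow> U.rdiff (Eta a) (Eta b) = Base d"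
  unfolding U.rdiff_def
  by (rule the_equality) (auto elim!: unit_plus_cases intro: left_cancel)

lemma le_Base: "a \<preceq> b \<Longrightarrow> U.le (Base a) (Base b)"
  unfolding U.le_def le_def by (metis unit_plus_Base_Base)

text \<open>The complement is the preimage under \<open>\<gamma>\<close> of the left remainder of
  \<open>a\<close> in \<open>b\<close>.\<close>

lemma le_Eta: "a \<preceq> b \<Longrightarrow> U.le (Eta b) (Eta a)"
  unfolding U.le_def le_iff_left by (metis gamma_surj unit_plus_Eta_Base)

lemma urel_bounds:
  assumes "gcr I" "urel x y"
  shows "\<exists>c d. U.le c x \<and> U.le x d \<and> U.le c y \<and> U.le y d \<and>
           urel (U.rdiff x c) (U.rdiff y c) \<and> urel (U.rdiff y c) (Base \<zero>) \<and>
           urel (U.rdiff d x) (U.rdiff d y) \<and> urel (U.rdiff d y) (Base \<zero>)"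
proof (cases x)
  case (Base a)
  then obtain b where b: "y = Base b" "a \<sim> b" using assms by (auto simp: urel_simps)
  obtain c i j where c: "i \<in> I" "j \<in> I" "i \<oplus> c = Some a" "j \<oplus> c = Some b"
    using b rel_iff_left by blast
  obtain d k l where d: "k \<in> I" "l \<in> I" "k \<oplus> a = Some d" "l \<oplus> b = Some d"
    using b assms by blast
  show ?thesis
    using Base b c d le_sum_right
    by (intro exI[of _ "Base c"] exI[of _ "Base d"])
      (auto simp: rdiff_Base rel_of_mem zero_mem intro!: le_Base)
next
  case (Eta a)
  then obtain b where b: "y = Eta b" "a \<sim> b" using assms by (auto simp: urel_simps)
  obtain c i j where c: "i \<in> I" "j \<in> I" "c \<oplus> i = Some a" "c \<oplus> j = Some b"
    using b rel_iff by blast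
  \<comment> \<open>The right-hand form of (GCR) is chosen because \<open>rdiff_Eta\<close> reads
    off right remainders.\<close>
  obtain d k l where d: "k \<in> I" "l \<in> I" "a \<oplus> k = Some d" "b \<oplus> l = Some d"
    using b assms upper_left_iff_upper_right by blast
  show ?thesis
    using Eta b c d le_sum_left
    by (intro exI[of _ "Eta d"] exI[of _ "Eta c"])
      (auto simp: rdiff_Eta rel_of_mem zero_mem intro!: le_Eta)
qed

section \<open>The two directions of the equivalence\<close>

lemma riesz_congruence_of_gcr: "gcr I \<Longrightarrow> U.riesz_congruence urel"
  unfolding U.riesz_congruence_def
  apply (intro conjI)
  subgoal by (rule congruence_urel)
  subgoal using urel_cancel_left urel_cancel_right by blast
  subgoal using urel_decompose by blast
  subgoal using urel_bounds by blast
  done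

lemma gcr_of_riesz_congruence:
  assumes "U.riesz_congruence urel"
  shows "gcr I"
proof (intro allI impI)
  fix a b
  assume "a \<sim> b"
  then have "urel (Base a) (Base b)" by simp
  then obtain d where d: "U.le (Base a) d" "U.le (Base b) d"
    and r: "urel (U.rdiff d (Base a)) (U.rdiff d (Base b))" "urel (U.rdiff d (Base b)) (Base \<zero>)"
    using assms unfolding U.riesz_congruence_def by blast
  \<comment> \<open>A bound in the \<open>Eta\<close> half would leave an \<open>Eta\<close>
    difference, which is never related to \<open>Base \<zero>\<close>.\<close>
  have "d \<noteq> Eta v" for v
  proof
    assume v: "d = Eta v"
    then obtain c where "v \<oplus> b = Some c"
      using d(2) by (auto simp: U.le_def elim: unit_plus_cases)
    \<comment> \<open>A left summand taking \<open>Base b\<close> to \<open>Eta v\<close> has the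
      form \<open>Eta w\<close> with this \<open>w\<close>; the unitizing condition makes the sum
      exist because \<open>v \<oplus> b\<close> does.\<close>
    then obtain w where w: "\<gamma> b \<oplus> v = Some w"
      using unitizing unfolding unitizing_automorphism_def by blast
    have "U.rdiff (Eta v) (Base b) = Eta w"
      unfolding U.rdiff_def using w by (intro the_equality) (auto elim!: unit_plus_cases)
    then show False using r(2) v by simp
  qed
  then obtain u where u: "d = Base u" by (cases d) auto
  have "a \<preceq> u" "b \<preceq> u"
    using d u by (auto simp: U.le_def le_def elim!: unit_plus_cases)
  then obtain i j where ij: "i \<oplus> a = Some u" "j \<oplus> b = Some u"
    unfolding le_iff_left by blast
  then have "i \<sim> j" "j \<sim> \<zero>"
    using r u by (auto simp: rdiff_Base)
  then have "i \<in> I" "j \<in> I" using rel_zero_iff rel_trans by blast+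
  then show "\<exists>i\<in>I. \<exists>j\<in>I. \<exists>s. i \<oplus> a = Some s \<and> j \<oplus> b = Some s" using ij by blast
qed

end

theorem theorem4p19:
  fixes oplus :: "'a \<Rightarrow> 'a \<Rightarrow> 'a option" (infixl "\<oplus>" 65)
    and zero :: 'a
    and \<gamma> :: "'a \<Rightarrow> 'a"
    and I :: "'a set"
  assumes "gpea oplus zero"
    and "partial_algebra.unitizing_automorphism oplus \<gamma>"
    and "partial_algebra.normal_ideal oplus I"
    and "partial_algebra.riesz_ideal oplus I"
    and "partial_algebra.gamma_ideal oplus \<gamma> I"
  shows "(partial_algebra.riesz_congruence (partial_algebra.unit_plus oplus \<gamma>) (Base zero)
            (star_rel (partial_algebra.ideal_rel oplus I)) \<longleftrightarrow>
          (\<forall>a b. partial_algebra.ideal_rel oplus I a b \<longrightarrow>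
             (\<exists>i\<in>I. \<exists>j\<in>I. \<exists>s. i \<oplus> a = Some s \<and> j \<oplus> b = Some s)))
       \<and> (\<forall>a b. partial_algebra.ideal_rel oplus I a b \<longrightarrow>
             ((\<exists>i\<in>I. \<exists>j\<in>I. \<exists>s. i \<oplus> a = Some s \<and> j \<oplus> b = Some s) \<longleftrightarrow>
              (\<exists>k\<in>I. \<exists>l\<in>I. \<exists>s. a \<oplus> k = Some s \<and> b \<oplus> l = Some s)))"
proof -
  interpret gpea oplus zero by fact
  interpret gpea_unitization_ideal oplus zero I \<gamma>
    by unfold_locales (use assms in auto)
  show ?thesis
    using riesz_congruence_of_gcr gcr_of_riesz_congruence upper_left_iff_upper_right by blast
qed

end
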